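(* Let $\mathcal{A}_1,\mathcal{A}_2$ (agents) and $\mathcal{B}_1,\mathcal{B}_2$ (tasks) be pairwise disjoint finite nonempty sets with $|\mathcal{A}_1|\ge|\mathcal{B}_1|$ and $|\mathcal{A}_2|\ge|\mathcal{B}_2|$. Put $\mathcal{A}_3=\mathcal{A}_1\cup\mathcal{A}_2$, $\mathcal{B}_3=\mathcal{B}_1\cup\mathcal{B}_2$, and for $k=1,2,3$ let $\mathcal{G}_k$ be the complete bipartite graph with vertex set $\mathcal{V}_k=\mathcal{A}_k\cup\mathcal{B}_k$ and edge set $\mathcal{E}_k=\{\{i,j\}\mid i\in\mathcal{A}_k,\ j\in\mathcal{B}_k\}$. Let $w:\mathcal{E}_3\to\mathbb{R}$ be a weight function. For $k=1,2$ let $\mathcal{M}_k$ be a solution to $BOT(\mathcal{G}_k)$, let $e_k\in\arg\max_{e\in\mathcal{M}_k}w(e)$, and assume that $e_k$ is a critical bottleneck edge of $\mathcal{G}_k$ relative to $\mathcal{M}_k$ and that $\mathcal{G}_k$ is a bottleneck cluster relative to $e_k$ (with solution $\mathcal{M}_k$). Let $\mathcal{S}_\mu(\mathcal{G}_1)$, $\mathcal{S}_\nu(\mathcal{G}_1)$ be alternating trees decomposing $\mathcal{G}_1$ with respect to $\mathcal{M}_1$ and $e_1$, as defined in the context, the former rooted at the agent of $e_1$ and the latter at the task of $e_1$. Assume that $w(e_1)>w(e_2)$ and that $\arg\max_{e\in\mathcal{M}_1}w(e)$ is a singleton. Let $e_3$ be a bottleneck edge of $\mathcal{G}_3$. Then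 $w(e_3)<w(e_1)$ if and only if there exist an agent $i\in\mathcal{A}_2$ and a task $j\in\mathcal{B}_2$ such that all of the following hold: (i) there is a task $b'$ in the vertex set of $\mathcal{S}_\nu(\mathcal{G}_1)$ with $w(\{i,b'\})<w(e_1)$; (ii) there is an agent $a'$ in the vertex set of $\mathcal{S}_\mu(\mathcal{G}_1)$ with $w(\{a',j\})<w(e_1)$; (iii) there is a path $P\subseteq\mathcal{E}_3$ between $i$ and $j$ that is alternating relative to $\mathcal{M}_2$, contains only edges of weight less than $w(e_1)$, and satisfies $|P\cap\mathcal{M}_2|>|P\setminus\mathcal{M}_2|$.
   Context: Matchings and BAP. A matching is a set of edges such that no vertex is incident with more than one of them; an MCM is a matching of maximum cardinality. For a complete bipartite graph $\mathcal{G}_b$ with agent set $\mathcal{A}_b$, task set $\mathcal{B}_b$, vertex set $\mathcal{V}_b=\mathcal{A}_b\cup\mathcal{B}_b$, edge set $\mathcal{E}_b$ and real edge weights $w$, the problem $BOT(\mathcal{G}_b)$ is to minimise $\max_{e\in\mathcal{M}}w(e)$ over all MCMs $\mathcal{M}$ of $\mathcal{G}_b$; a solution is an MCM attaining the minimum. A bottleneck edge of $\mathcal{G}_b$ is any $e\in\arg\max_{e'\in\mathcal{M}}w(e')$ for any solution $\mathcal{M}$ of $BOT(\mathcal{G}_b)$. Paths. A path between $v_1$ and $v_{l+1}$ is a set of edges $\{\{v_k,v_{k+1}\}\}_{k=1,\dots,l}$ with $v_1,\dots,v_{l+1}$ distinct vertices; $l$ is its length (the empty path, $l=0$, joins a vertex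 to itself). A path $P$ is alternating relative to a matching $\mathcal{M}$ if every vertex incident to an edge of $P$ is incident with at most one edge of $P\cap\mathcal{M}$ and at most one edge of $P\setminus\mathcal{M}$. A vertex is free relative to $\mathcal{M}$ if it is incident with no edge of $\mathcal{M}$. An augmenting path relative to $\mathcal{M}$ is an alternating path relative to $\mathcal{M}$ of length at least one between two (distinct) free vertices. A tree with a designated root is an alternating tree relative to $\mathcal{M}$ if the path in the tree from the root to every other vertex is alternating relative to $\mathcal{M}$. Pruned edge set. For an MCM $\mathcal{M}$ of $\mathcal{G}_b$, $\phi(\mathcal{G}_b,\mathcal{M})=\mathcal{M}\cup\{e\in\mathcal{E}_b\mid w(e)<\max_{e'\in\mathcal{M}}w(e')\}$. Critical bottleneck edge. For an MCM $\mathcal{M}$ of $\mathcal{G}_b$, an edge $e_c$ is a critical bottleneck edge of $\mathcal{G}_b$ relative to $\mathcal{M}$ if $e_c\in\arg\max_{e\in\mathcal{M}}w(e)$ and $\phi(\mathcal{G}_b,\mathcal{M})\setminus\{e_c\}$ does not contain an augmenting path relative to $\mathcal{M}\setminus\{e_c\}$. Bottleneck cluster. Let $\mathcal{M}_b$ be a solution to $BOT(\mathcal{G}_b)$ and $e=\{a_b,b_b\}\in\mathcal{M}_b$ (with $a_b$ an agent, $b_b$ a task) a bottleneck edge of $\mathcal{G}_b$. $\mathcal{G}_b$ is a bottleneck cluster relative to $e$ (with solution $\mathcal{M}_b$) if for every vertex $v\in\mathcal{V}_b$ there is a path $P\subseteq\phi(\mathcal{G}_b,\mathcal{M}_b)$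 between $v$ and $b_b$ that is alternating relative to $\mathcal{M}_b$ (for $v=b_b$ the empty path is allowed). Tree decomposition. Let $\mathcal{M}_b$ be a solution to $BOT(\mathcal{G}_b)$, $e_c=\{a_c,b_c\}\in\mathcal{M}_b$ ($a_c$ agent, $b_c$ task) a critical bottleneck edge of $\mathcal{G}_b$ relative to $\mathcal{M}_b$, and $\mathcal{G}_b$ a bottleneck cluster relative to $e_c$. Then $\mathcal{S}_\mu(\mathcal{G}_b)=(\mathcal{V}_\mu,\mathcal{E}_\mu)$ and $\mathcal{S}_\nu(\mathcal{G}_b)=(\mathcal{V}_\nu,\mathcal{E}_\nu)$ denote subgraphs of $\mathcal{G}_b$ with $a_c\in\mathcal{V}_\mu$, $b_c\in\mathcal{V}_\nu$, $\mathcal{V}_\mu\cup\mathcal{V}_\nu=\mathcal{V}_b$, $\mathcal{V}_\mu\cap\mathcal{V}_\nu=\emptyset$, $\mathcal{E}_\mu\cup\mathcal{E}_\nu\subseteq\phi(\mathcal{G}_b,\mathcal{M}_b)$, that are alternating trees relative to $\mathcal{M}_b$ with roots $a_c$ and $b_c$ respectively. In the theorem this is applied to $\mathcal{G}_1$ with $\mathcal{M}_1$ and $e_1$. *)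

theory Defs
  imports Complex_Main
begin

text \<open>Undirected graphs are given by a vertex set and a set of edges, an edge being the
  two-element set of its endpoints.\<close>

definition complete_bipartite :: "'a set \<Rightarrow> 'a set \<Rightarrow> 'a set set" where
  "complete_bipartite A B = {{i, j} |i j. i \<in> A \<and> j \<in> B}"

definition matching :: "'a set set \<Rightarrow> 'a set set \<Rightarrow> bool" where
  "matching E M \<longleftrightarrow> M \<subseteq> E \<and> (\<forall>v. \<exists>\<^sub>\<le>\<^sub>1 e. e \<in> M \<and> v \<in> e)"

text \<open>The following notions are meant for finite edge sets: \<^const>\<open>card\<close> is \<open>0\<close> on
  infinite sets. Likewise \<^const>\<open>Max\<close> is only meaningful on nonempty matchings.\<close>

definition max_card_matching :: "'a set set \<Rightarrow> 'a set set \<Rightarrow> bool" where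
  "max_card_matching E M \<longleftrightarrow> is_arg_max card (matching E) M"

definition bot_solution :: "('a set \<Rightarrow> real) \<Rightarrow> 'a set set \<Rightarrow> 'a set set \<Rightarrow> bool" where
  "bot_solution w E M \<longleftrightarrow> is_arg_min (\<lambda>N. Max (w ` N)) (max_card_matching E) M"

definition argmax_edges :: "('a set \<Rightarrow> real) \<Rightarrow> 'a set set \<Rightarrow> 'a set set" where
  "argmax_edges w M = {e. is_arg_max w (\<lambda>e'. e' \<in> M) e}"

definition bottleneck_edge :: "('a set \<Rightarrow> real) \<Rightarrow> 'a set set \<Rightarrow> 'a set \<Rightarrow> bool" where
  "bottleneck_edge w E e \<longleftrightarrow> (\<exists>M. bot_solution w E M \<and> e \<in> argmax_edges w M)"

text \<open>A path is a set of edges, obtained from a nonempty list of distinct vertices. The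
  one-vertex list gives the empty path, which joins a vertex to itself.\<close>

definition walk_edges :: "'a list \<Rightarrow> 'a set set" where
  "walk_edges vs = {{vs ! k, vs ! Suc k} |k. Suc k < length vs}"

definition path_between :: "'a \<Rightarrow> 'a \<Rightarrow> 'a set set \<Rightarrow> bool" where
  "path_between u v P \<longleftrightarrow>
     (\<exists>vs. vs \<noteq> [] \<and> distinct vs \<and> hd vs = u \<and> last vs = v \<and> P = walk_edges vs)"

definition alternating :: "'a set set \<Rightarrow> 'a set set \<Rightarrow> bool" where
  "alternating M P \<longleftrightarrow>
     (\<forall>v \<in> \<Union>P. (\<exists>\<^sub>\<le>\<^sub>1 e. e \<in> P \<inter> M \<and> v \<in> e) \<and> (\<exists>\<^sub>\<le>\<^sub>1 e. e \<in> P - M \<and> v \<in> e))"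

definition free_vertex :: "'a set set \<Rightarrow> 'a \<Rightarrow> bool" where
  "free_vertex M v \<longleftrightarrow> \<not> (\<exists>e \<in> M. v \<in> e)"

definition augmenting_path :: "'a set set \<Rightarrow> 'a set set \<Rightarrow> bool" where
  "augmenting_path M P \<longleftrightarrow> alternating M P \<and> P \<noteq> {} \<and>
     (\<exists>u v. u \<noteq> v \<and> free_vertex M u \<and> free_vertex M v \<and> path_between u v P)"

definition pruned_edges :: "('a set \<Rightarrow> real) \<Rightarrow> 'a set set \<Rightarrow> 'a set set \<Rightarrow> 'a set set" where
  "pruned_edges w E M = M \<union> {e \<in> E. w e < Max (w ` M)}"

definition critical_bottleneck_edge ::
    "('a set \<Rightarrow> real) \<Rightarrow> 'a set set \<Rightarrow> 'a set set \<Rightarrow> 'a set \<Rightarrow> bool" where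
  "critical_bottleneck_edge w E M e \<longleftrightarrow>
     max_card_matching E M \<and> e \<in> argmax_edges w M \<and>
     \<not> (\<exists>P \<subseteq> pruned_edges w E M - {e}. augmenting_path (M - {e}) P)"

definition bottleneck_cluster ::
    "('a set \<Rightarrow> real) \<Rightarrow> 'a set \<Rightarrow> 'a set \<Rightarrow> 'a set set \<Rightarrow> 'a set \<Rightarrow> bool" where
  "bottleneck_cluster w A B M e \<longleftrightarrow>
     bot_solution w (complete_bipartite A B) M \<and> e \<in> M \<and>
     bottleneck_edge w (complete_bipartite A B) e \<and>
     (\<exists>a \<in> A. \<exists>b \<in> B. e = {a, b} \<and>
        (\<forall>v \<in> A \<union> B. \<exists>P \<subseteq> pruned_edges w (complete_bipartite A B) M.
           path_between v b P \<and> alternating M P))"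

definition is_cycle :: "'a set set \<Rightarrow> bool" where
  "is_cycle C \<longleftrightarrow>
     (\<exists>vs. length vs \<ge> 3 \<and> distinct vs \<and> C = insert {last vs, hd vs} (walk_edges vs))"

definition is_tree :: "'a set \<Rightarrow> 'a set set \<Rightarrow> bool" where
  "is_tree V E \<longleftrightarrow>
     V \<noteq> {} \<and> (\<forall>e \<in> E. e \<subseteq> V \<and> card e = 2) \<and>
     (\<forall>u \<in> V. \<forall>v \<in> V. \<exists>P \<subseteq> E. path_between u v P) \<and>
     \<not> (\<exists>C \<subseteq> E. is_cycle C)"

definition alternating_tree :: "'a set set \<Rightarrow> 'a set \<Rightarrow> 'a set set \<Rightarrow> 'a \<Rightarrow> bool" where
  "alternating_tree M V E r \<longleftrightarrow>
     is_tree V E \<and> r \<in> V \<and>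
     (\<forall>v \<in> V - {r}. \<forall>P \<subseteq> E. path_between r v P \<longrightarrow> alternating M P)"

text \<open>The trees are \<open>(V\<^sub>\<mu>, E\<^sub>\<mu>)\<close>, rooted at the agent \<open>a\<close>, and \<open>(V\<^sub>\<nu>, E\<^sub>\<nu>)\<close>, rooted at the
  task \<open>b\<close>. They are not determined by the other arguments, hence a relation.\<close>

definition tree_decomposition ::
    "('a set \<Rightarrow> real) \<Rightarrow> 'a set \<Rightarrow> 'a set \<Rightarrow> 'a set set \<Rightarrow> 'a \<Rightarrow> 'a \<Rightarrow>
     'a set \<Rightarrow> 'a set set \<Rightarrow> 'a set \<Rightarrow> 'a set set \<Rightarrow> bool" where
  "tree_decomposition w A B M a b V\<^sub>\<mu> E\<^sub>\<mu> V\<^sub>\<nu> E\<^sub>\<nu> \<longleftrightarrow>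
     a \<in> V\<^sub>\<mu> \<and> b \<in> V\<^sub>\<nu> \<and> V\<^sub>\<mu> \<union> V\<^sub>\<nu> = A \<union> B \<and> V\<^sub>\<mu> \<inter> V\<^sub>\<nu> = {} \<and>
     E\<^sub>\<mu> \<union> E\<^sub>\<nu> \<subseteq> pruned_edges w (complete_bipartite A B) M \<and>
     alternating_tree M V\<^sub>\<mu> E\<^sub>\<mu> a \<and> alternating_tree M V\<^sub>\<nu> E\<^sub>\<nu> b"

end

theory Submission
  imports Defs
begin

text \<open>A critical bottleneck edge of a cluster leaves no agent free: an alternating path from a
  free agent to the task of the edge would be augmenting. Hence \<open>M\<^sub>1 \<union> M\<^sub>2\<close> is a perfect matching
  \<open>m\<close> of the joined graph, all of whose edges except \<open>e\<^sub>1\<close> are light, i.e. lighter than \<open>e\<^sub>1\<close>.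
  Relate tasks by \<open>s \<rightarrow> t\<close> if \<open>{s, m t}\<close> is light. Comparing a light perfect matching with \<open>m\<close>
  gives a permutation of the tasks, so such a matching exists iff \<open>b\<^sub>1\<close> lies on a cycle of this
  relation. By optimality of \<open>M\<^sub>1\<close> no cycle through \<open>b\<^sub>1\<close> stays in \<open>B\<^sub>1\<close>; therefore the two trees
  consist exactly of the vertices reachable from \<open>b\<^sub>1\<close> and of those from which \<open>b\<^sub>1\<close> is
  reachable, and a cycle must leave the first tree through \<open>B\<^sub>2\<close> and come back into the second
  one. The stay in \<open>B\<^sub>2\<close> is the path of condition (iii).\<close>


section \<open>Matchings of complete bipartite graphs\<close>

lemma matching_unique:
  assumes "matching E M" "e \<in> M" "f \<in> M" "v \<in> e" "v \<in> f"
  shows "e = f"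
  using assms unfolding matching_def Uniq_def by blast

lemma complete_bipartite_commute: "complete_bipartite A B = complete_bipartite B A"
  unfolding complete_bipartite_def by (auto simp: insert_commute)

text \<open>Injectivity of \<open>\<mu>\<close> keeps two edges from sharing an agent, and
  disjointness of the sides keeps a vertex from being an agent in one edge and a task in another.
  For the same reasons distinct tasks give distinct edges, whence the cardinality.\<close>

lemma matching_image:
  assumes "inj_on \<mu> B" "\<mu> ` B \<subseteq> A" "A \<inter> B = {}"
  shows "matching (complete_bipartite A B) ((\<lambda>t. {\<mu> t, t}) ` B)"
    and "card ((\<lambda>t. {\<mu> t, t}) ` B) = card B"
proof -
  show "matching (complete_bipartite A B) ((\<lambda>t. {\<mu> t, t}) ` B)"
    unfolding matching_def Uniq_def complete_bipartite_def
  proof (intro conjI subsetI allI impI)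
    fix v e f
    assume "e \<in> (\<lambda>t. {\<mu> t, t}) ` B \<and> v \<in> e" "f \<in> (\<lambda>t. {\<mu> t, t}) ` B \<and> v \<in> f"
    then obtain s t where "s \<in> B" "t \<in> B" "e = {\<mu> s, s}" "f = {\<mu> t, t}" "v \<in> e" "v \<in> f"
      by blast
    moreover from this assms(2) have "\<mu> s \<in> A" "\<mu> t \<in> A"
      by auto
    ultimately show "e = f"
      using assms(1,3) inj_onD[OF assms(1), of s t] by auto
  qed (use assms(2) in blast)
  have "inj_on (\<lambda>t. {\<mu> t, t}) B"
    using assms unfolding inj_on_def by (auto simp: doubleton_eq_iff)
  then show "card ((\<lambda>t. {\<mu> t, t}) ` B) = card B"
    by (rule card_image)
qed

text \<open>Each edge contains a task, and in a matching different edges contain different ones. The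
  choice function is exported together with the bound because it becomes onto \<open>B\<close> as
  soon as the cardinalities agree.\<close>

lemma matching_card_le:
  assumes "matching (complete_bipartite A B) M" "finite B"
  obtains f where "inj_on f M" "f ` M \<subseteq> B" "\<And>e. e \<in> M \<Longrightarrow> f e \<in> e" "card M \<le> card B"
proof -
  have "\<forall>e \<in> M. \<exists>t \<in> B. t \<in> e"
    using assms(1) unfolding matching_def complete_bipartite_def by blast
  then obtain f where f: "\<forall>e \<in> M. f e \<in> B \<and> f e \<in> e"
    by metis
  then have "inj_on f M"
    by (metis assms(1) inj_onI matching_unique)
  with f show thesis
    using assms(2) card_inj_on_le[of f M B] that[of f] by auto
qed

lemma max_card_matching_image:
  assumes "inj_on \<mu> B" "\<mu> ` B \<subseteq> A" "A \<inter> B = {}" "finite B"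
  shows "max_card_matching (complete_bipartite A B) ((\<lambda>t. {\<mu> t, t}) ` B)"
  unfolding max_card_matching_def is_arg_max_def
  using matching_image[OF assms(1-3)] matching_card_le[OF _ assms(4)] by (metis leD)

text \<open>An injection of the tasks into the agents yields a matching with \<open>card B\<close>
  edges, so a maximum one has at least as many. Choosing the task of each edge is then onto
  \<open>B\<close>: every task is matched, and \<open>\<mu>\<close> reads off its partner.\<close>

lemma max_card_matching_eq_image:
  assumes "max_card_matching (complete_bipartite A B) M"
    and "finite A" "finite B" "A \<inter> B = {}" "card B \<le> card A"
  obtains \<mu> where "inj_on \<mu> B" "\<mu> ` B \<subseteq> A" "M = (\<lambda>t. {\<mu> t, t}) ` B"
proof -
  have M: "matching (complete_bipartite A B) M"
    using assms(1) unfolding max_card_matching_def is_arg_max_def by blast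
  obtain \<nu> where "inj_on \<nu> B" "\<nu> ` B \<subseteq> A"
    using assms(2,3,5) by (metis card_le_inj)
  then have "card B \<le> card M"
    using assms(1) matching_image[of \<nu> B A] assms(4)
    unfolding max_card_matching_def is_arg_max_def by (metis not_less)
  moreover obtain f where f: "inj_on f M" "f ` M \<subseteq> B" "\<And>e. e \<in> M \<Longrightarrow> f e \<in> e"
    using matching_card_le[OF M assms(3)] by metis
  ultimately have fM: "f ` M = B"
    by (metis assms(3) card_image card_seteq)
  have "\<forall>t \<in> B. \<exists>i \<in> A. {i, t} \<in> M"
  proof
    fix t assume "t \<in> B"
    then obtain e where e: "e \<in> M" "t \<in> e"
      using fM f(3) by blast
    then obtain i j where "i \<in> A" "j \<in> B" "e = {i, j}"
      using M unfolding matching_def complete_bipartite_def by blast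
    then show "\<exists>i \<in> A. {i, t} \<in> M"
      using e \<open>t \<in> B\<close> assms(4) by auto
  qed
  then obtain \<mu> where \<mu>: "\<forall>t \<in> B. \<mu> t \<in> A \<and> {\<mu> t, t} \<in> M"
    by metis
  show thesis
  proof (rule that[of \<mu>])
    show "inj_on \<mu> B"
    proof (rule inj_onI)
      fix s t assume "s \<in> B" "t \<in> B" "\<mu> s = \<mu> t"
      then have "{\<mu> s, s} = {\<mu> t, t}"
        using \<mu> matching_unique[OF M] by (metis insertI1)
      then show "s = t"
        using \<open>\<mu> s = \<mu> t\<close> by (metis doubleton_eq_iff)
    qed
    show "M = (\<lambda>t. {\<mu> t, t}) ` B"
    proof
      show "M \<subseteq> (\<lambda>t. {\<mu> t, t}) ` B"
      proof
        fix e assume "e \<in> M"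
        then have "f e \<in> B" "f e \<in> e"
          using f by auto
        then have "e = {\<mu> (f e), f e}"
          using matching_unique[OF M \<open>e \<in> M\<close>] \<mu> by blast
        then show "e \<in> (\<lambda>t. {\<mu> t, t}) ` B"
          using \<open>f e \<in> B\<close> by blast
      qed
    qed (use \<mu> in blast)
  qed (use \<mu> in blast)
qed

lemma argmax_edges_eq_Max:
  assumes "finite M" "e \<in> argmax_edges w M"
  shows "e \<in> M" "w e = Max (w ` M)"
proof -
  show "e \<in> M"
    using assms(2) unfolding argmax_edges_def is_arg_max_def by blast
  moreover have "w f \<le> w e" if "f \<in> M" for f
    using assms(2) that unfolding argmax_edges_def is_arg_max_def by (auto simp: not_less)
  ultimately show "w e = Max (w ` M)"
    using assms(1) by (intro Max_eqI[symmetric]) auto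
qed

text \<open>The solution itself gives one direction; in the other, any such injection is a maximum
  matching whose heaviest edge bounds the optimum. The threshold is left free so that the criterion
  serves both the first graph and the joined one.\<close>

lemma bottleneck_less_iff:
  assumes "bot_solution w (complete_bipartite A B) M" "e \<in> argmax_edges w M"
    and "finite A" "finite B" "A \<inter> B = {}" "card B \<le> card A" "B \<noteq> {}"
  shows "w e < \<theta> \<longleftrightarrow> (\<exists>\<mu>. inj_on \<mu> B \<and> \<mu> ` B \<subseteq> A \<and> (\<forall>t \<in> B. w {\<mu> t, t} < \<theta>))"
proof -
  have M: "max_card_matching (complete_bipartite A B) M"
    and opt: "\<And>N. max_card_matching (complete_bipartite A B) N \<Longrightarrow> Max (w ` M) \<le> Max (w ` N)"
    using assms(1) unfolding bot_solution_def is_arg_min_def by (auto simp: not_less)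
  obtain \<mu> where \<mu>: "inj_on \<mu> B" "\<mu> ` B \<subseteq> A" "M = (\<lambda>t. {\<mu> t, t}) ` B"
    using max_card_matching_eq_image[OF M] assms by metis
  have e: "w e = Max (w ` M)"
    using argmax_edges_eq_Max assms(2,4) \<mu>(3) by blast
  show ?thesis
  proof
    assume "w e < \<theta>"
    then have "\<forall>t \<in> B. w {\<mu> t, t} < \<theta>"
      using e \<mu>(3) assms(4,7) by simp
    with \<mu> show "\<exists>\<mu>. inj_on \<mu> B \<and> \<mu> ` B \<subseteq> A \<and> (\<forall>t \<in> B. w {\<mu> t, t} < \<theta>)"
      by blast
  next
    assume "\<exists>\<mu>. inj_on \<mu> B \<and> \<mu> ` B \<subseteq> A \<and> (\<forall>t \<in> B. w {\<mu> t, t} < \<theta>)"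
    then obtain \<nu> where \<nu>: "inj_on \<nu> B" "\<nu> ` B \<subseteq> A" "\<forall>t \<in> B. w {\<nu> t, t} < \<theta>"
      by blast
    have "Max (w ` (\<lambda>t. {\<nu> t, t}) ` B) < \<theta>"
      using \<nu>(3) assms(4,7) by simp
    then show "w e < \<theta>"
      using opt[OF max_card_matching_image[OF \<nu>(1,2) assms(5,4)]] e by simp
  qed
qed


section \<open>Alternating paths\<close>

lemma walk_edges_nth: "Suc k < length vs \<Longrightarrow> {vs ! k, vs ! Suc k} \<in> walk_edges vs"
  unfolding walk_edges_def by blast

lemma walk_edges_tl: "walk_edges (tl vs) \<subseteq> walk_edges vs"
proof
  fix e assume "e \<in> walk_edges (tl vs)"
  then obtain k where "Suc k < length (tl vs)" "e = {tl vs ! k, tl vs ! Suc k}"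
    unfolding walk_edges_def by blast
  then show "e \<in> walk_edges vs"
    using walk_edges_nth[of "Suc k" vs] by (simp add: nth_tl)
qed

lemma alternating_subset: "alternating M P \<Longrightarrow> Q \<subseteq> P \<Longrightarrow> alternating M Q"
  unfolding alternating_def Uniq_def by (intro ballI conjI allI impI) blast+

text \<open>Two consecutive edges are distinct and meet in the middle vertex, so alternation there
  forbids that both are matched or both unmatched.\<close>

lemma alternating_step:
  assumes "distinct vs" "alternating M (walk_edges vs)" "Suc (Suc k) < length vs"
  shows "{vs ! Suc k, vs ! Suc (Suc k)} \<in> M \<longleftrightarrow> {vs ! k, vs ! Suc k} \<notin> M"
proof -
  let ?e = "{vs ! k, vs ! Suc k}" and ?f = "{vs ! Suc k, vs ! Suc (Suc k)}"
  have "vs ! k \<noteq> vs ! Suc k" "vs ! k \<noteq> vs ! Suc (Suc k)"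
    using assms(1,3) by (simp_all add: nth_eq_iff_index_eq)
  then have "?e \<noteq> ?f"
    by (auto simp: doubleton_eq_iff)
  moreover have "?e \<in> walk_edges vs" "?f \<in> walk_edges vs" "vs ! Suc k \<in> ?e" "vs ! Suc k \<in> ?f"
    using assms(3) walk_edges_nth[of k vs] walk_edges_nth[of "Suc k" vs] by auto
  ultimately show ?thesis
    using assms(2) unfolding alternating_def Uniq_def by blast
qed

lemma alternating_parity:
  assumes "distinct vs" "alternating M (walk_edges vs)" "Suc k < length vs"
  shows "{vs ! k, vs ! Suc k} \<in> M \<longleftrightarrow> (even k \<longleftrightarrow> {vs ! 0, vs ! Suc 0} \<in> M)"
  using assms(3)
proof (induction k)
  case (Suc k)
  then show ?case
    using alternating_step[OF assms(1,2), of k] by auto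
qed simp

lemma bipartite_parity:
  assumes "walk_edges vs \<subseteq> complete_bipartite A B" "A \<inter> B = {}" "vs ! 0 \<in> A" "k < length vs"
  shows "if even k then vs ! k \<in> A else vs ! k \<in> B"
  using assms(4)
proof (induction k)
  case (Suc k)
  then have "{vs ! k, vs ! Suc k} \<in> complete_bipartite A B"
    using walk_edges_nth assms(1) by blast
  then show ?case
    using Suc assms(2) unfolding complete_bipartite_def by (auto simp: doubleton_eq_iff)
qed (use assms(3) in simp)


section \<open>Critical edges and free agents\<close>

text \<open>Removing \<open>{a, b}\<close> from the matching frees \<open>b\<close>. A path from a
  free agent to \<open>b\<close> has odd length and begins with an unmatched edge, hence also ends
  with one; it therefore avoids \<open>{a, b}\<close> and would be augmenting for the reduced
  matching.\<close>

lemma critical_edge_no_path_from_free: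
  assumes "critical_bottleneck_edge w (complete_bipartite A B) M {a, b}"
    and "a \<in> A" "b \<in> B" "{a, b} \<in> M" "A \<inter> B = {}"
    and "v \<in> A" "free_vertex M v" "path_between v b P" "alternating M P"
  shows "\<not> P \<subseteq> pruned_edges w (complete_bipartite A B) M"
proof
  assume P: "P \<subseteq> pruned_edges w (complete_bipartite A B) M"
  have M: "matching (complete_bipartite A B) M"
    using assms(1) unfolding critical_bottleneck_edge_def max_card_matching_def is_arg_max_def
    by blast
  then have PE: "P \<subseteq> complete_bipartite A B"
    using P unfolding pruned_edges_def matching_def by blast
  obtain vs where vs: "vs \<noteq> []" "distinct vs" "hd vs = v" "last vs = b" "P = walk_edges vs"
    using assms(8) unfolding path_between_def by blast
  define n where "n = length vs - 1"
  have ends: "vs ! 0 = v" "vs ! n = b" "n < length vs"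
    using vs(1,3,4) unfolding n_def by (simp_all add: hd_conv_nth last_conv_nth)
  have par: "if even k then vs ! k \<in> A else vs ! k \<in> B" if "k < length vs" for k
    using bipartite_parity[OF PE[unfolded vs(5)] assms(5) _ that] ends(1) assms(6) by simp
  have "odd n"
    using par[OF ends(3)] ends(2) assms(3,5) by (auto split: if_splits)
  then have "Suc 0 < length vs"
    using ends(3) by (cases n) auto
  moreover have "{vs ! 0, vs ! Suc 0} \<notin> M"
    using assms(7) ends(1) unfolding free_vertex_def by blast
  ultimately have notM: "{vs ! k, vs ! Suc k} \<notin> M" if "even k" "Suc k < length vs" for k
    using alternating_parity[OF vs(2) assms(9)[unfolded vs(5)]] that by blast
  \<comment> \<open>As \<open>b\<close> is the last vertex, only the last edge contains it. That
    edge has the even index \<open>n - 1\<close> and is unmatched.\<close>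
  have "{a, b} \<notin> P"
  proof
    assume "{a, b} \<in> P"
    then obtain k where k: "Suc k < length vs" "{a, b} = {vs ! k, vs ! Suc k}"
      unfolding vs(5) walk_edges_def by blast
    then have "vs ! k = b \<or> vs ! Suc k = b"
      by (auto simp: doubleton_eq_iff)
    then have "k = n \<or> Suc k = n"
      using vs(2) ends(2,3) k(1) by (metis Suc_lessD nth_eq_iff_index_eq)
    then have "Suc k = n"
      using k(1) unfolding n_def by auto
    then have "even k"
      using \<open>odd n\<close> by (metis even_Suc)
    then show False
      using notM k assms(4) by simp
  qed
  \<comment> \<open>Since the path avoids the deleted edge, its division into matched and unmatched
    edges is unchanged, and alternation carries over.\<close>
  then have "P \<subseteq> pruned_edges w (complete_bipartite A B) M - {{a, b}}"
    and "P \<inter> (M - {{a, b}}) = P \<inter> M" "P - (M - {{a, b}}) = P - M"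
    using P by auto
  moreover have "free_vertex (M - {{a, b}}) b" "free_vertex (M - {{a, b}}) v"
    using matching_unique[OF M _ assms(4), of _ b] assms(7) unfolding free_vertex_def by blast+
  moreover have "P \<noteq> {}" "v \<noteq> b"
    using \<open>Suc 0 < length vs\<close> walk_edges_nth[of 0 vs] vs(5) assms(3,5,6) by auto
  moreover from calculation have "alternating (M - {{a, b}}) P"
    using assms(9) unfolding alternating_def by simp
  ultimately have "augmenting_path (M - {{a, b}}) P"
    using assms(8) unfolding augmenting_path_def by blast
  with \<open>P \<subseteq> pruned_edges w (complete_bipartite A B) M - {{a, b}}\<close> show False
    using assms(1) unfolding critical_bottleneck_edge_def by blast
qed

lemma cluster_no_free_agent:
  assumes "bottleneck_cluster w A B M e" "critical_bottleneck_edge w (complete_bipartite A B) M e"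
    and "A \<inter> B = {}"
  shows "A \<subseteq> \<Union>M"
proof
  fix v assume "v \<in> A"
  obtain a b where "a \<in> A" "b \<in> B" "e = {a, b}" "{a, b} \<in> M"
    and "\<forall>v \<in> A \<union> B. \<exists>P \<subseteq> pruned_edges w (complete_bipartite A B) M.
           path_between v b P \<and> alternating M P"
    using assms(1) unfolding bottleneck_cluster_def by auto
  then show "v \<in> \<Union>M"
    using critical_edge_no_path_from_free[of w A B M a b v] assms(2,3) \<open>v \<in> A\<close>
    unfolding free_vertex_def by blast
qed

text \<open>A maximum matching covers all tasks because there are enough agents; with no agent free,
  the injection from tasks to agents is also onto.\<close>

lemma cluster_perfect_matching:
  assumes "bottleneck_cluster w A B M e" "critical_bottleneck_edge w (complete_bipartite A B) M e"
    and "finite A" "finite B" "A \<inter> B = {}" "card B \<le> card A"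
  obtains m where "bij_betw m B A" "M = (\<lambda>t. {m t, t}) ` B"
proof -
  have "max_card_matching (complete_bipartite A B) M"
    using assms(2) unfolding critical_bottleneck_edge_def by blast
  then obtain m where m: "inj_on m B" "m ` B \<subseteq> A" "M = (\<lambda>t. {m t, t}) ` B"
    using max_card_matching_eq_image assms(3-6) by metis
  moreover have "A \<subseteq> m ` B"
    using cluster_no_free_agent[OF assms(1,2,5)] m(3) assms(5) by blast
  ultimately show thesis
    using that unfolding bij_betw_def by blast
qed


section \<open>Paths in alternating trees\<close>

lemma alternating_tree_edge_subset: "alternating_tree M V E r \<Longrightarrow> e \<in> E \<Longrightarrow> e \<subseteq> V"
  unfolding alternating_tree_def is_tree_def by simp

lemma alternating_tree_path:
  assumes "alternating_tree M V E r" "v \<in> V" "v \<noteq> r"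
  obtains P where "P \<subseteq> E" "path_between r v P" "alternating M P"
proof -
  have "r \<in> V" "\<And>u. u \<in> V \<Longrightarrow> \<exists>P \<subseteq> E. path_between u v P"
    "\<And>P. P \<subseteq> E \<Longrightarrow> path_between r v P \<Longrightarrow> alternating M P"
    using assms unfolding alternating_tree_def is_tree_def by simp_all
  then show thesis
    using that by blast
qed


section \<open>Exchanges along a perfect matching\<close>

text \<open>The pairs \<open>{x t, y t}\<close> are the edges of a perfect matching, indexed by \<open>t\<close>. An
  alternating path is a path of this relation, where \<open>s \<rightarrow> t\<close> is one edge outside the
  matching, from \<open>x s\<close> to \<open>y t\<close>, followed by the matching edge to \<open>x t\<close>.\<close>

definition exchange ::
    "('a set \<Rightarrow> real) \<Rightarrow> real \<Rightarrow> ('b \<Rightarrow> 'a) \<Rightarrow> ('b \<Rightarrow> 'a) \<Rightarrow> 'b set \<Rightarrow> ('b \<times> 'b) set" where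
  "exchange w \<theta> x y T = {(s, t). s \<in> T \<and> t \<in> T \<and> w {x s, y t} < \<theta>}"

text \<open>Interchanging the two ends of the matching edges reverses every step. Walks that start
  at an agent can thus be treated like walks that start at a task.\<close>

lemma exchange_converse: "exchange w \<theta> x y T = (exchange w \<theta> y x T)\<inverse>"
  unfolding exchange_def by (auto simp: insert_commute)

lemma exchange_mono: "S \<subseteq> T \<Longrightarrow> exchange w \<theta> x y S \<subseteq> exchange w \<theta> x y T"
  unfolding exchange_def by blast

text \<open>The only matching edge at the start \<open>x r\<close> is excluded, so the first edge is
  unmatched and parity decides all others. An edge leaving an \<open>x\<close>-vertex is a step of
  the relation, and an edge leaving a \<open>y\<close>-vertex is a matching edge, which keeps the
  index. Odd positions come after at least one step, hence the transitive closure there.\<close>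

lemma alternating_walk_exchange:
  assumes M: "M = (\<lambda>t. {x t, y t}) ` T" "inj_on x T" "inj_on y T" "x ` T \<inter> y ` T = {}"
    and vs: "distinct vs" "vs ! 0 = x r" "r \<in> T" "alternating M (walk_edges vs)"
      "walk_edges vs \<subseteq> complete_bipartite (x ` T) (y ` T)"
    and "{x r, y r} \<notin> walk_edges vs"
    and light: "\<And>e. e \<in> walk_edges vs \<Longrightarrow> w e < \<theta>"
    and "k < length vs"
  shows "if even k then \<exists>t \<in> T. vs ! k = x t \<and> (r, t) \<in> (exchange w \<theta> x y T)\<^sup>*
         else \<exists>t \<in> T. vs ! k = y t \<and> (r, t) \<in> (exchange w \<theta> x y T)\<^sup>+"
  using assms(12)
proof (induction k)
  case (Suc k)
  have e: "{vs ! k, vs ! Suc k} \<in> walk_edges vs"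
    using walk_edges_nth Suc.prems by blast
  have "{vs ! 0, vs ! Suc 0} \<notin> M"
  proof
    assume *: "{vs ! 0, vs ! Suc 0} \<in> M"
    then obtain t where t: "t \<in> T" "{vs ! 0, vs ! Suc 0} = {x t, y t}"
      using M(1) by blast
    then have "x r = x t"
      using vs(2,3) M(4) by (auto simp: doubleton_eq_iff)
    then have "t = r"
      using M(2) t(1) vs(3) by (simp add: inj_on_eq_iff)
    moreover have "{vs ! 0, vs ! Suc 0} \<in> walk_edges vs"
      using walk_edges_nth[of 0 vs] Suc.prems by auto
    ultimately show False
      using t(2) assms(10) by simp
  qed
  then have inM: "{vs ! k, vs ! Suc k} \<in> M \<longleftrightarrow> odd k"
    using alternating_parity[OF vs(1,4) Suc.prems] by blast
  show ?case
  proof (cases "even k")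
    case True
    then obtain s where s: "s \<in> T" "vs ! k = x s" "(r, s) \<in> (exchange w \<theta> x y T)\<^sup>*"
      using Suc by auto
    have "vs ! Suc k \<in> y ` T"
      using bipartite_parity[OF vs(5) M(4) _ Suc.prems] vs(2,3) True by simp
    then obtain t where t: "t \<in> T" "vs ! Suc k = y t"
      by blast
    have "(s, t) \<in> exchange w \<theta> x y T"
      using s t light[OF e] unfolding exchange_def by simp
    with s(3) have "(r, t) \<in> (exchange w \<theta> x y T)\<^sup>+"
      by (rule rtrancl_into_trancl1)
    with t True show ?thesis
      by auto
  next
    case False
    then obtain s where s: "s \<in> T" "vs ! k = y s" "(r, s) \<in> (exchange w \<theta> x y T)\<^sup>+"
      using Suc by auto
    obtain t where t: "t \<in> T" "{vs ! k, vs ! Suc k} = {x t, y t}"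
      using inM False M(1) by blast
    then have "y s = y t \<and> vs ! Suc k = x t"
      using s M(4) by (auto simp: doubleton_eq_iff)
    then have "vs ! Suc k = x s"
      using s(1) t(1) M(3) by (simp add: inj_on_eq_iff)
    with s False show ?thesis
      by (auto intro: trancl_into_rtrancl)
  qed
qed (use vs(2,3) in auto)

section \<open>Cycles and permutations\<close>

text \<open>Extend the path step by step; if the new point has occurred already, cut the path back
  to that occurrence.\<close>

lemma rtrancl_distinct_path:
  assumes "(b, c) \<in> r\<^sup>*"
  shows "\<exists>ts. ts \<noteq> [] \<and> distinct ts \<and> hd ts = b \<and> last ts = c \<and>
           successively (\<lambda>s t. (s, t) \<in> r) ts"
  using assms
proof (induction rule: rtrancl_induct)
  case base
  show ?case
    by (intro exI[of _ "[b]"]) simp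
next
  case (step y z)
  then obtain ts where ts: "ts \<noteq> []" "distinct ts" "hd ts = b" "last ts = y"
    "successively (\<lambda>s t. (s, t) \<in> r) ts"
    by blast
  show ?case
  proof (cases "z \<in> set ts")
    case True
    then obtain us vs where "ts = us @ z # vs"
      by (meson split_list)
    with ts show ?thesis
      by (intro exI[of _ "us @ [z]"])
        (auto simp: successively_append_iff hd_append split: if_splits)
  next
    case False
    with ts step(2) show ?thesis
      by (intro exI[of _ "ts @ [z]"]) (auto simp: successively_append_iff)
  qed
qed

lemma successively_subset:
  assumes "ts \<noteq> []" "hd ts \<in> T" "successively (\<lambda>s t. (s, t) \<in> r) ts" "r \<subseteq> T \<times> T"
  shows "set ts \<subseteq> T"
  using assms by (induction ts rule: list_nonempty_induct) (auto simp: successively_Cons)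

text \<open>The permutation sends each entry to its successor and the last one back to the head.
  That closing move is not claimed to lie in \<open>r\<close>; it is supplied where a cycle is
  given.\<close>

lemma cyclic_shift:
  assumes "ts \<noteq> []" "distinct ts" "successively (\<lambda>s t. (s, t) \<in> r) ts"
  shows "\<exists>\<pi>. \<pi> ` set ts = set ts \<and> \<pi> (last ts) = hd ts \<and>
           (\<forall>t \<in> set ts - {last ts}. (t, \<pi> t) \<in> r)"
  using assms
proof (induction ts rule: list_nonempty_induct)
  case (single t)
  show ?case
    by (intro exI[of _ id]) simp
next
  case (cons t ts)
  then obtain \<pi> where \<pi>: "\<pi> ` set ts = set ts" "\<pi> (last ts) = hd ts"
    "\<forall>s \<in> set ts - {last ts}. (s, \<pi> s) \<in> r"
    by (auto simp: successively_Cons)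
  have last: "last ts \<in> set ts" "t \<notin> set ts" "t \<noteq> last ts"
    using cons by auto
  \<comment> \<open>The new head is inserted into the cycle between the last entry and the old
    head.\<close>
  define \<rho> where "\<rho> = \<pi>(last ts := t, t := hd ts)"
  have "inj_on \<pi> (set ts)"
    using \<pi>(1) by (simp add: eq_card_imp_inj_on)
  then have "\<pi> ` (set ts - {last ts}) = set ts - {hd ts}"
    using \<pi>(1,2) last(1) by (simp add: inj_on_image_set_diff)
  moreover have "\<rho> ` (set ts - {last ts}) = \<pi> ` (set ts - {last ts})"
    unfolding \<rho>_def using last by (intro image_cong) auto
  moreover have "set (t # ts) = insert t (insert (last ts) (set ts - {last ts}))"
    using last by auto
  moreover have "\<rho> t = hd ts" "\<rho> (last ts) = t"
    unfolding \<rho>_def using last by auto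
  moreover have "hd ts \<in> set ts"
    using cons(1) by simp
  ultimately have "\<rho> ` set (t # ts) = set (t # ts)"
    by auto
  moreover have "\<forall>s \<in> set (t # ts) - {last (t # ts)}. (s, \<rho> s) \<in> r"
    using \<pi>(3) cons(1,4) last unfolding \<rho>_def by (auto simp: successively_Cons)
  ultimately show ?case
    using \<open>\<rho> (last ts) = t\<close> cons(1) by (intro exI[of _ \<rho>]) auto
qed

text \<open>Given \<pi>, let \<open>Y\<close> be the points reached from \<open>b\<close> in at
  least one step. Then \<pi> maps \<open>insert b Y\<close> injectively into \<open>Y\<close>, which
  by counting forces \<open>b\<close> into \<open>Y\<close>. Conversely, a cycle through
  \<open>b\<close> without repetitions is rotated and all other points are fixed.\<close>

lemma permutation_iff_cycle:
  assumes "finite T" "b \<in> T" "r \<subseteq> T \<times> T" "\<And>t. t \<in> T - {b} \<Longrightarrow> (t, t) \<in> r"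
  shows "(\<exists>\<pi>. bij_betw \<pi> T T \<and> (\<forall>t \<in> T. (t, \<pi> t) \<in> r)) \<longleftrightarrow> (b, b) \<in> r\<^sup>+"
proof
  assume "\<exists>\<pi>. bij_betw \<pi> T T \<and> (\<forall>t \<in> T. (t, \<pi> t) \<in> r)"
  then obtain \<pi> where \<pi>: "bij_betw \<pi> T T" "\<forall>t \<in> T. (t, \<pi> t) \<in> r"
    by blast
  define Y where "Y = {t. (b, t) \<in> r\<^sup>+}"
  have Y: "Y \<subseteq> T"
    unfolding Y_def using assms(3) by (auto dest: trancl_subset_Sigma[THEN subsetD, rotated])
  then have "\<pi> ` insert b Y \<subseteq> Y"
    using \<pi>(2) assms(2) unfolding Y_def by (auto intro: trancl_into_trancl)
  moreover have "inj_on \<pi> (insert b Y)"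
    using \<pi>(1) Y assms(2) unfolding bij_betw_def by (meson inj_on_subset insert_subsetI)
  ultimately have "card (insert b Y) \<le> card Y"
    using Y assms(1) by (meson card_inj_on_le finite_subset)
  then have "b \<in> Y"
    using finite_subset[OF Y assms(1)] by (cases "b \<in> Y") auto
  then show "(b, b) \<in> r\<^sup>+"
    unfolding Y_def by simp
next
  assume "(b, b) \<in> r\<^sup>+"
  then obtain c where c: "(b, c) \<in> r\<^sup>*" "(c, b) \<in> r"
    by (meson tranclD2)
  then obtain ts where ts: "ts \<noteq> []" "distinct ts" "hd ts = b" "last ts = c"
    "successively (\<lambda>s t. (s, t) \<in> r) ts"
    using rtrancl_distinct_path by metis
  then obtain \<pi> where \<pi>: "\<pi> ` set ts = set ts" "\<pi> c = b" "\<forall>t \<in> set ts - {c}. (t, \<pi> t) \<in> r"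
    using cyclic_shift by metis
  have r: "(t, \<pi> t) \<in> r" if "t \<in> set ts" for t
    using \<pi>(2,3) c(2) that by (cases "t = c") auto
  then have "set ts \<subseteq> T"
    using assms(3) by blast
  have "b \<in> set ts"
    using ts(1,3) by auto
  \<comment> \<open>Fixed points are steps of \<open>r\<close> because only \<open>b\<close> may
    lack a loop, and \<open>b\<close> lies on the cycle.\<close>
  define \<rho> where "\<rho> t = (if t \<in> set ts then \<pi> t else t)" for t
  have "\<rho> ` T = \<rho> ` set ts \<union> \<rho> ` (T - set ts)"
    using \<open>set ts \<subseteq> T\<close> by blast
  also have "\<dots> = \<pi> ` set ts \<union> (T - set ts)"
    unfolding \<rho>_def by simp
  finally have "\<rho> ` T = T"
    using \<pi>(1) \<open>set ts \<subseteq> T\<close> by (simp add: Un_absorb1)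
  moreover from this have "inj_on \<rho> T"
    using assms(1) by (intro eq_card_imp_inj_on) simp_all
  ultimately have "bij_betw \<rho> T T"
    unfolding bij_betw_def by blast
  moreover have "\<forall>t \<in> T. (t, \<rho> t) \<in> r"
    using r assms(4) \<open>b \<in> set ts\<close> unfolding \<rho>_def by auto
  ultimately show "\<exists>\<pi>. bij_betw \<pi> T T \<and> (\<forall>t \<in> T. (t, \<pi> t) \<in> r)"
    by blast
qed

text \<open>A second perfect matching \<open>\<mu>\<close> is \<open>m \<circ> \<pi>\<close> for a permutation \<open>\<pi>\<close> of \<open>B\<close>.\<close>

lemma light_matching_iff_cycle:
  assumes "bij_betw m B A" "finite B" "b \<in> B" "\<And>t. t \<in> B - {b} \<Longrightarrow> w {m t, t} < \<theta>"
  shows "(\<exists>\<mu>. inj_on \<mu> B \<and> \<mu> ` B \<subseteq> A \<and> (\<forall>t \<in> B. w {\<mu> t, t} < \<theta>)) \<longleftrightarrow>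
    (b, b) \<in> (exchange w \<theta> (\<lambda>t. t) m B)\<^sup>+" (is "?L \<longleftrightarrow> (b, b) \<in> ?r\<^sup>+")
proof -
  have "?L \<longleftrightarrow> (\<exists>\<pi>. bij_betw \<pi> B B \<and> (\<forall>t \<in> B. (t, \<pi> t) \<in> ?r))"
  proof
    assume ?L
    then obtain \<mu> where \<mu>: "inj_on \<mu> B" "\<mu> ` B \<subseteq> A" "\<forall>t \<in> B. w {\<mu> t, t} < \<theta>"
      by blast
    let ?\<pi> = "the_inv_into B m \<circ> \<mu>"
    have inv: "bij_betw (the_inv_into B m) A B"
      using assms(1) by (rule bij_betw_the_inv_into)
    then have "inj_on ?\<pi> B"
      using \<mu>(1,2) by (metis bij_betw_def comp_inj_on inj_on_subset)
    moreover have maps: "?\<pi> ` B \<subseteq> B"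
      using \<mu>(2) inv unfolding bij_betw_def by auto
    ultimately have "bij_betw ?\<pi> B B"
      using assms(2) unfolding bij_betw_def by (metis endo_inj_surj)
    moreover have "m (?\<pi> t) = \<mu> t" if "t \<in> B" for t
      using assms(1) \<mu>(2) that unfolding bij_betw_def by (auto simp: f_the_inv_into_f)
    ultimately show "\<exists>\<pi>. bij_betw \<pi> B B \<and> (\<forall>t \<in> B. (t, \<pi> t) \<in> ?r)"
      using \<mu>(3) maps unfolding exchange_def
      by (intro exI[of _ ?\<pi>]) (auto simp: insert_commute)
  next
    assume "\<exists>\<pi>. bij_betw \<pi> B B \<and> (\<forall>t \<in> B. (t, \<pi> t) \<in> ?r)"
    then obtain \<pi> where \<pi>: "bij_betw \<pi> B B" "\<forall>t \<in> B. (t, \<pi> t) \<in> ?r"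
      by blast
    have "bij_betw (m \<circ> \<pi>) B A"
      using \<pi>(1) assms(1) by (rule bij_betw_trans)
    with \<pi>(2) show ?L
      unfolding exchange_def bij_betw_def
      by (intro exI[of _ "m \<circ> \<pi>"]) (auto simp: insert_commute)
  qed
  \<comment> \<open>The light matching edges \<open>{m t, t}\<close> are the loops of the relation
    at the tasks other than \<open>b\<close>.\<close>
  also have "\<dots> \<longleftrightarrow> (b, b) \<in> ?r\<^sup>+"
    using assms(2-4)
    by (intro permutation_iff_cycle) (auto simp: exchange_def insert_commute)
  finally show ?thesis .
qed


section \<open>Exchange paths and alternating paths\<close>

lemma walk_edges_Cons: "walk_edges (x # y # zs) = insert {x, y} (walk_edges (y # zs))"
proof -
  have "{k. Suc k < length (x # y # zs)} = insert 0 (Suc ` {k. Suc k < length (y # zs)})"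
    by (auto simp: image_iff less_Suc_eq_0_disj)
  moreover have "walk_edges us = (\<lambda>k. {us ! k, us ! Suc k}) ` {k. Suc k < length us}" for us :: "'a list"
    unfolding walk_edges_def by blast
  ultimately show ?thesis
    by (simp add: image_image)
qed

text \<open>Placing the agent \<open>m t\<close> before each task \<open>t\<close> turns a path of
  tasks into a path of the graph. The first set holds the matching edges, the second the links from
  a task to the agent of the next one.\<close>

lemma walk_edges_interleave:
  assumes "ts \<noteq> []"
  shows "walk_edges (concat (map (\<lambda>t. [m t, t]) ts)) =
    (\<lambda>t. {m t, t}) ` set ts \<union> (\<lambda>(s, t). {s, m t}) ` set (zip ts (tl ts))"
  using assms
proof (induction ts rule: list_nonempty_induct)
  case (single t)
  show ?case
    by (simp add: walk_edges_Cons) (simp add: walk_edges_def)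
next
  case (cons t ts)
  then obtain u us where "ts = u # us"
    by (meson neq_Nil_conv)
  with cons.IH show ?case
    by (simp add: walk_edges_Cons) blast
qed

lemma distinct_interleave:
  assumes "distinct ts" "inj_on m (set ts)" "m ` set ts \<inter> set ts = {}"
  shows "distinct (concat (map (\<lambda>t. [m t, t]) ts))"
  using assms by (induction ts) (auto simp: image_iff)

lemma in_set_zip_tl:
  "(s, t) \<in> set (zip ts (tl ts)) \<longleftrightarrow> (\<exists>k. Suc k < length ts \<and> s = ts ! k \<and> t = ts ! Suc k)"
  by (auto simp: in_set_zip nth_tl less_diff_conv)

lemma zip_tl_unique:
  assumes "distinct ts" "(s, t) \<in> set (zip ts (tl ts))" "(s', t') \<in> set (zip ts (tl ts))"
  shows "s = s' \<longleftrightarrow> t = t'" and "s \<noteq> t"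
  using assms by (auto simp: in_set_zip_tl nth_eq_iff_index_eq)

lemma successively_zip_tl:
  "successively r ts \<Longrightarrow> (s, t) \<in> set (zip ts (tl ts)) \<Longrightarrow> r s t"
  by (auto simp: in_set_zip_tl successively_conv_nth)

text \<open>Interleave a repetition-free path of tasks with their agents. The result begins and ends
  with a matching edge, so the matched edges outnumber the links between them.\<close>

lemma exchange_alternating_path:
  assumes "bij_betw m B A" "A \<inter> B = {}" "s \<in> B" "\<And>t. t \<in> B \<Longrightarrow> w {m t, t} < \<theta>"
    and "M = (\<lambda>t. {m t, t}) ` B" "(s, t) \<in> (exchange w \<theta> (\<lambda>t. t) m B)\<^sup>*"
  shows "\<exists>P \<subseteq> complete_bipartite A B. path_between (m s) t P \<and> alternating M P \<and>
    (\<forall>e \<in> P. w e < \<theta>) \<and> card (P - M) < card (P \<inter> M)"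
proof -
  obtain ts where ts: "ts \<noteq> []" "distinct ts" "hd ts = s" "last ts = t"
    "successively (\<lambda>s t. (s, t) \<in> exchange w \<theta> (\<lambda>t. t) m B) ts"
    using rtrancl_distinct_path[OF assms(6)] by blast
  define vs where "vs = concat (map (\<lambda>t. [m t, t]) ts)"
  define Z where "Z = set (zip ts (tl ts))"
  define In where "In = (\<lambda>t. {m t, t}) ` set ts"
  define Out where "Out = (\<lambda>(s, t). {s, m t}) ` Z"
  have r: "s \<in> B" "t \<in> B" "w {s, m t} < \<theta>" if "(s, t) \<in> Z" for s t
    using successively_zip_tl[OF ts(5)] that unfolding Z_def exchange_def by auto
  have uniq: "s = s' \<longleftrightarrow> t = t'" "s \<noteq> t" if "(s, t) \<in> Z" "(s', t') \<in> Z" for s t s' t'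
    using zip_tl_unique[OF ts(2)] that unfolding Z_def by blast+
  have sub: "set ts \<subseteq> B"
    using ts(3) assms(3) by (intro successively_subset[OF ts(1) _ ts(5)]) (auto simp: exchange_def)
  have inj: "inj_on m B" and mA: "\<And>t. t \<in> B \<Longrightarrow> m t \<in> A"
    using assms(1) unfolding bij_betw_def by auto
  have m_eq: "m s = m t \<longleftrightarrow> s = t" if "s \<in> B" "t \<in> B" for s t
    using inj that by (simp add: inj_on_eq_iff)
  have neq: "m s \<noteq> t" if "s \<in> B" "t \<in> B" for s t
    using mA assms(2) that by blast
  have P: "walk_edges vs = In \<union> Out"
    unfolding vs_def In_def Out_def Z_def using ts(1) by (rule walk_edges_interleave)
  have In: "In \<subseteq> M"
    unfolding In_def assms(5) using sub by blast
  have Out: "Out \<inter> M = {}"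
  proof -
    \<comment> \<open>Equality would give \<open>s = u\<close> and \<open>m t = m u\<close>, hence
      \<open>s = t\<close>, but a link joins different entries of the list.\<close>
    have "{s, m t} \<noteq> {m u, u}" if "(s, t) \<in> Z" "u \<in> B" for s t u
      using r[OF that(1)] uniq(2)[OF that(1) that(1)] that(2) neq m_eq
      by (metis doubleton_eq_iff)
    then show ?thesis
      unfolding Out_def assms(5) by auto
  qed
  have "walk_edges vs \<subseteq> complete_bipartite A B"
    unfolding P In_def Out_def complete_bipartite_def using sub r mA
    by (auto simp: insert_commute) blast+
  moreover have "path_between (m s) t (walk_edges vs)"
  proof -
    have "distinct vs"
      unfolding vs_def using ts(2) inj sub neq
      by (intro distinct_interleave) (auto intro: inj_on_subset)
    moreover have "vs \<noteq> []" "hd vs = m s"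
      unfolding vs_def using ts(1,3) by (cases ts; simp)+
    moreover have "last vs = t"
      unfolding vs_def using ts(1,4) by (cases ts rule: rev_cases) simp_all
    ultimately show ?thesis
      unfolding path_between_def by blast
  qed
  moreover have "alternating M (walk_edges vs)"
    unfolding alternating_def Uniq_def
  proof (intro ballI conjI allI impI)
    fix v e f
    assume "e \<in> walk_edges vs \<inter> M \<and> v \<in> e" "f \<in> walk_edges vs \<inter> M \<and> v \<in> f"
    then show "e = f"
      using assms(5) matching_unique[OF matching_image(1)[OF inj _ assms(2)]] mA by blast
  next
    fix v e f
    assume "e \<in> walk_edges vs - M \<and> v \<in> e" "f \<in> walk_edges vs - M \<and> v \<in> f"
    then have "e \<in> Out" "f \<in> Out" "v \<in> e" "v \<in> f"
      using P In by auto
    then obtain s t s' t' where *: "(s, t) \<in> Z" "(s', t') \<in> Z" "e = {s, m t}" "f = {s', m t'}"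
      unfolding Out_def by auto
    \<comment> \<open>Links that share a vertex share it as a task or as an agent; in a distinct
      list either end determines the other.\<close>
    then have "v = s \<and> v = s' \<or> v = m t \<and> v = m t'"
      using \<open>v \<in> e\<close> \<open>v \<in> f\<close> r neq by (metis empty_iff insert_iff)
    then show "e = f"
      using * uniq(1)[OF *(1,2)] m_eq r by metis
  qed
  moreover have "\<forall>e \<in> walk_edges vs. w e < \<theta>"
    unfolding P In_def Out_def using assms(4) sub r(3) by auto
  moreover have "card (walk_edges vs - M) < card (walk_edges vs \<inter> M)"
  proof -
    \<comment> \<open>There is one matching edge for each entry of \<open>ts\<close>, but a link
      only for each pair of neighbours, which is one fewer.\<close>
    have "card Out \<le> card Z"
      unfolding Out_def Z_def by (intro card_image_le) simp
    also have "\<dots> \<le> length (zip ts (tl ts))"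
      unfolding Z_def by (rule card_length)
    also have "\<dots> < length ts"
      using ts(1) by simp
    also have "\<dots> = card (set ts)"
      using ts(2) by (simp add: distinct_card)
    also have "\<dots> = card In"
      unfolding In_def using inj_on_subset[OF inj sub] mA sub assms(2)
      by (intro matching_image(2)[symmetric, where A = A]) auto
    moreover have "walk_edges vs - M = Out" "walk_edges vs \<inter> M = In"
      using P In Out by auto
    ultimately show ?thesis
      by simp
  qed
  ultimately show ?thesis
    by blast
qed

text \<open>The path has odd length, so the surplus of matched edges forces it to begin and end with
  one. All its vertices are then covered by \<open>M\<close>, which confines it to \<open>A\<close>
  and \<open>B\<close> although it is only assumed to lie in the larger graph. Without its first
  vertex it is a walk of the exchange relation.\<close>

lemma alternating_path_exchange:
  assumes "bij_betw m B A" "M = (\<lambda>t. {m t, t}) ` B" "A \<subseteq> A'" "B \<subseteq> B'" "A' \<inter> B' = {}"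
    and "i \<in> A" "j \<in> B" "P \<subseteq> complete_bipartite A' B'" "path_between i j P" "alternating M P"
    and "\<And>e. e \<in> P \<Longrightarrow> w e < \<theta>" "card (P - M) < card (P \<inter> M)"
  shows "\<exists>s \<in> B. i = m s \<and> (s, j) \<in> (exchange w \<theta> (\<lambda>t. t) m B)\<^sup>*"
proof -
  obtain vs where vs: "vs \<noteq> []" "distinct vs" "hd vs = i" "last vs = j" "P = walk_edges vs"
    using assms(9) unfolding path_between_def by blast
  define n where "n = length vs - 1"
  have ends: "vs ! 0 = i" "vs ! n = j" "length vs = Suc n"
    using vs(1,3,4) unfolding n_def by (simp_all add: hd_conv_nth last_conv_nth)
  have par: "if even k then vs ! k \<in> A' else vs ! k \<in> B'" if "k < length vs" for k
    using bipartite_parity[OF assms(8)[unfolded vs(5)] assms(5) _ that] ends(1) assms(3,6)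
    by auto
  have "odd n"
    using par[of n] ends assms(4,5,7) by (auto split: if_splits)
  define edge where "edge k = {vs ! k, vs ! Suc k}" for k
  have P: "P = edge ` {..<n}"
    unfolding vs(5) walk_edges_def edge_def ends(3) by auto
  have in_M: "edge k \<in> M \<longleftrightarrow> (even k \<longleftrightarrow> edge 0 \<in> M)" if "k < n" for k
    using alternating_parity[OF vs(2) assms(10)[unfolded vs(5)], of k] that ends(3)
    unfolding edge_def by simp
  have edge_inj: "inj_on edge {..<n}"
    using vs(2) ends(3) unfolding edge_def
    by (intro inj_onI) (auto simp: doubleton_eq_iff nth_eq_iff_index_eq)
  \<comment> \<open>Otherwise the matched edges sit at the odd positions, and shifting these by one
    embeds them into the even ones.\<close>
  have "edge 0 \<in> M"
  proof (rule ccontr)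
    assume "edge 0 \<notin> M"
    then have "P \<inter> M = edge ` {k. k < n \<and> odd k}" "P - M = edge ` {k. k < n \<and> even k}"
      using P in_M by auto
    moreover have "card (edge ` {k. k < n \<and> odd k}) \<le> card {k. k < n \<and> odd k}"
      by (intro card_image_le) simp
    moreover have "card {k. k < n \<and> odd k} \<le> card {k. k < n \<and> even k}"
      by (intro card_inj_on_le[of "\<lambda>k. k - 1"]) (auto intro!: inj_onI elim!: oddE)
    moreover have "card (edge ` {k. k < n \<and> even k}) = card {k. k < n \<and> even k}"
      by (intro card_image inj_on_subset[OF edge_inj]) auto
    ultimately show False
      using assms(12) by simp
  qed
  then have M_even: "edge k \<in> M" if "k < n" "even k" for k
    using in_M that by blast
  \<comment> \<open>Each vertex lies on an edge of even index: its own or the preceding one. For the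
    last vertex this uses that \<open>n\<close> is odd.\<close>
  have V: "vs ! k \<in> A \<union> B" if "k < length vs" for k
  proof -
    have "edge (if even k then k else k - 1) \<in> M"
      using that ends(3) \<open>odd n\<close> odd_pos[OF \<open>odd n\<close>] by (intro M_even) (auto simp: less_Suc_eq)
    moreover have "vs ! k \<in> edge (if even k then k else k - 1)"
      unfolding edge_def by (auto elim!: oddE)
    ultimately show ?thesis
      using assms(1,2) unfolding bij_betw_def by auto
  qed
  have PE: "P \<subseteq> complete_bipartite A B"
  proof
    fix e assume "e \<in> P"
    then obtain k where k: "Suc k < length vs" "e = {vs ! k, vs ! Suc k}"
      unfolding vs(5) walk_edges_def by blast
    then have "e \<subseteq> A \<union> B"
      using V[of k] V[of "Suc k"] by simp
    moreover obtain a b where "a \<in> A'" "b \<in> B'" "e = {a, b}"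
      using \<open>e \<in> P\<close> assms(8) unfolding complete_bipartite_def by blast
    ultimately show "e \<in> complete_bipartite A B"
      using assms(3-5) unfolding complete_bipartite_def by blast
  qed
  have "0 < n"
    using \<open>odd n\<close> by (rule odd_pos)
  obtain s where s: "s \<in> B" "edge 0 = {m s, s}"
    using \<open>edge 0 \<in> M\<close> assms(2) by blast
  have AB: "A \<inter> B = {}"
    using assms(3-5) by blast
  have mA: "m ` B = A" "inj_on m B"
    using assms(1) unfolding bij_betw_def by auto
  have first: "vs ! 0 = m s" "vs ! Suc 0 = s"
    using s ends(1) assms(6) AB unfolding edge_def by (auto simp: doubleton_eq_iff)
  have tl: "walk_edges (tl vs) \<subseteq> P"
    using walk_edges_tl vs(5) by blast
  have "m s \<notin> set (tl vs)"
    using vs(1,2,3) first(1) ends(1) by (metis distinct.simps(2) list.collapse)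
  moreover have "\<Union>(walk_edges (tl vs)) \<subseteq> set (tl vs)"
    unfolding walk_edges_def by auto
  ultimately have "{s, m s} \<notin> walk_edges (tl vs)"
    by blast
  \<comment> \<open>The shortened walk starts at the task \<open>s\<close>, so tasks take the role
    of \<open>x\<close> and agents that of \<open>y\<close>. It ends at the even index
    \<open>n - 1\<close>, hence in the first case.\<close>
  then have "if even (n - 1)
    then \<exists>t \<in> B. tl vs ! (n - 1) = t \<and> (s, t) \<in> (exchange w \<theta> (\<lambda>t. t) m B)\<^sup>*
    else \<exists>t \<in> B. tl vs ! (n - 1) = m t \<and> (s, t) \<in> (exchange w \<theta> (\<lambda>t. t) m B)\<^sup>+"
    using vs(2) first(2) s(1) assms(2,10,11) tl mA AB PE \<open>0 < n\<close> ends(3)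
    by (intro alternating_walk_exchange[where M = M])
      (auto simp: distinct_tl nth_tl insert_commute inf_commute
        complete_bipartite_commute[of B] intro: alternating_subset)
  then have "(s, j) \<in> (exchange w \<theta> (\<lambda>t. t) m B)\<^sup>*"
    using \<open>odd n\<close> ends(2,3) \<open>0 < n\<close> by (auto simp: nth_tl)
  with s(1) first(1) ends(1) show ?thesis
    by blast
qed


theorem theorem2:
  fixes A\<^sub>1 A\<^sub>2 B\<^sub>1 B\<^sub>2 :: "'a set"
    and w :: "'a set \<Rightarrow> real"
    and M\<^sub>1 M\<^sub>2 :: "'a set set"
    and e\<^sub>1 e\<^sub>2 e\<^sub>3 :: "'a set"
    and a\<^sub>1 b\<^sub>1 :: 'a
    and V\<^sub>\<mu> V\<^sub>\<nu> :: "'a set"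
    and E\<^sub>\<mu> E\<^sub>\<nu> :: "'a set set"
  assumes "finite A\<^sub>1" "finite A\<^sub>2" "finite B\<^sub>1" "finite B\<^sub>2"
    and "A\<^sub>1 \<noteq> {}" "A\<^sub>2 \<noteq> {}" "B\<^sub>1 \<noteq> {}" "B\<^sub>2 \<noteq> {}"
    and "A\<^sub>1 \<inter> A\<^sub>2 = {}" "B\<^sub>1 \<inter> B\<^sub>2 = {}" "A\<^sub>1 \<inter> B\<^sub>1 = {}"
    and "A\<^sub>1 \<inter> B\<^sub>2 = {}" "A\<^sub>2 \<inter> B\<^sub>1 = {}" "A\<^sub>2 \<inter> B\<^sub>2 = {}"
    and "card A\<^sub>1 \<ge> card B\<^sub>1" "card A\<^sub>2 \<ge> card B\<^sub>2"
    and "bot_solution w (complete_bipartite A\<^sub>1 B\<^sub>1) M\<^sub>1"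
    and "bot_solution w (complete_bipartite A\<^sub>2 B\<^sub>2) M\<^sub>2"
    and "e\<^sub>1 \<in> argmax_edges w M\<^sub>1"
    and "e\<^sub>2 \<in> argmax_edges w M\<^sub>2"
    and "critical_bottleneck_edge w (complete_bipartite A\<^sub>1 B\<^sub>1) M\<^sub>1 e\<^sub>1"
    and "critical_bottleneck_edge w (complete_bipartite A\<^sub>2 B\<^sub>2) M\<^sub>2 e\<^sub>2"
    and "bottleneck_cluster w A\<^sub>1 B\<^sub>1 M\<^sub>1 e\<^sub>1"
    and "bottleneck_cluster w A\<^sub>2 B\<^sub>2 M\<^sub>2 e\<^sub>2"
    and "a\<^sub>1 \<in> A\<^sub>1" "b\<^sub>1 \<in> B\<^sub>1" "e\<^sub>1 = {a\<^sub>1, b\<^sub>1}"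
    and "tree_decomposition w A\<^sub>1 B\<^sub>1 M\<^sub>1 a\<^sub>1 b\<^sub>1 V\<^sub>\<mu> E\<^sub>\<mu> V\<^sub>\<nu> E\<^sub>\<nu>"
    and "w e\<^sub>1 > w e\<^sub>2"
    and "is_singleton (argmax_edges w M\<^sub>1)"
    and "bottleneck_edge w (complete_bipartite (A\<^sub>1 \<union> A\<^sub>2) (B\<^sub>1 \<union> B\<^sub>2)) e\<^sub>3"
  shows "w e\<^sub>3 < w e\<^sub>1 \<longleftrightarrow>
    (\<exists>i \<in> A\<^sub>2. \<exists>j \<in> B\<^sub>2.
       (\<exists>b' \<in> V\<^sub>\<nu> \<inter> B\<^sub>1. w {i, b'} < w e\<^sub>1) \<and>
       (\<exists>a' \<in> V\<^sub>\<mu> \<inter> A\<^sub>1. w {a', j} < w e\<^sub>1) \<and>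
       (\<exists>P \<subseteq> complete_bipartite (A\<^sub>1 \<union> A\<^sub>2) (B\<^sub>1 \<union> B\<^sub>2).
          path_between i j P \<and> alternating M\<^sub>2 P \<and> (\<forall>e \<in> P. w e < w e\<^sub>1) \<and>
          card (P \<inter> M\<^sub>2) > card (P - M\<^sub>2)))"
proof -

  \<comment> \<open>The joint matching and its light edges\<close>
  note fin = assms(1-4) and ne = assms(5-8) and disj = assms(9-14) and cards = assms(15,16)
  let ?E1 = "complete_bipartite A\<^sub>1 B\<^sub>1"
  define \<theta> where "\<theta> = w e\<^sub>1"
  obtain m\<^sub>1 where m1: "bij_betw m\<^sub>1 B\<^sub>1 A\<^sub>1" "M\<^sub>1 = (\<lambda>t. {m\<^sub>1 t, t}) ` B\<^sub>1"
    using cluster_perfect_matching[OF assms(23,21) fin(1,3) disj(3) cards(1)] .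
  obtain m\<^sub>2 where m2: "bij_betw m\<^sub>2 B\<^sub>2 A\<^sub>2" "M\<^sub>2 = (\<lambda>t. {m\<^sub>2 t, t}) ` B\<^sub>2"
    using cluster_perfect_matching[OF assms(24,22) fin(2,4) disj(6) cards(2)] .
  \<comment> \<open>A single function for both graphs lets one relation \<open>r\<close> contain the
    exchanges inside each of them and between them.\<close>
  define m where "m t = (if t \<in> B\<^sub>1 then m\<^sub>1 t else m\<^sub>2 t)" for t
  have bij1: "bij_betw m B\<^sub>1 A\<^sub>1"
    using m1(1) by (rule bij_betw_cong[THEN iffD1, rotated]) (simp add: m_def)
  have bij2: "bij_betw m B\<^sub>2 A\<^sub>2"
    using m2(1) by (rule bij_betw_cong[THEN iffD1, rotated]) (use disj(2) in \<open>auto simp: m_def\<close>)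
  have bij3: "bij_betw m (B\<^sub>1 \<union> B\<^sub>2) (A\<^sub>1 \<union> A\<^sub>2)"
    using bij1 bij2 disj(1) by (rule bij_betw_combine)
  have M1: "M\<^sub>1 = (\<lambda>t. {m t, t}) ` B\<^sub>1"
    unfolding m1(2) m_def by simp
  have M2: "M\<^sub>2 = (\<lambda>t. {m t, t}) ` B\<^sub>2"
    unfolding m2(2) m_def using disj(2) by (intro image_cong) auto
  note A = bij1[THEN bij_betw_imp_surj_on] bij2[THEN bij_betw_imp_surj_on]
  note inj = bij1[THEN bij_betw_imp_inj_on] bij2[THEN bij_betw_imp_inj_on]
  have finM: "finite M\<^sub>1" "finite M\<^sub>2"
    using fin M1 M2 by auto
  have Max1: "Max (w ` M\<^sub>1) = \<theta>"
    using argmax_edges_eq_Max[OF finM(1) assms(19)] \<theta>_def by simp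
  have e1: "e\<^sub>1 \<in> M\<^sub>1"
    using argmax_edges_eq_Max[OF finM(1) assms(19)] by simp
  have mb1: "m b\<^sub>1 = a\<^sub>1"
  proof -
    obtain t where t: "t \<in> B\<^sub>1" "{a\<^sub>1, b\<^sub>1} = {m t, t}"
      using e1 assms(27) M1 by blast
    moreover have "a\<^sub>1 \<noteq> t"
      using t(1) assms(25) disj(3) by blast
    ultimately show ?thesis
      by (metis doubleton_eq_iff)
  qed
  have M1_le: "w e \<le> \<theta>" if "e \<in> M\<^sub>1" for e
    using that finM(1) Max1 by (metis Max_ge finite_imageI imageI)
  have M1_light: "w e < \<theta>" if "e \<in> M\<^sub>1" "e \<noteq> e\<^sub>1" for e
  proof -
    \<comment> \<open>Another edge of weight \<theta> would be a second maximiser in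
      \<open>M\<^sub>1\<close>.\<close>
    have "w e \<noteq> \<theta>"
    proof
      assume "w e = \<theta>"
      then have "e \<in> argmax_edges w M\<^sub>1"
        using that(1) M1_le unfolding argmax_edges_def is_arg_max_def by (auto simp: not_less)
      then show False
        using assms(19,30) that(2) by (metis is_singletonE singletonD)
    qed
    then show ?thesis
      using M1_le[OF that(1)] by simp
  qed
  have M2_light: "w e < \<theta>" if "e \<in> M\<^sub>2" for e
    using argmax_edges_eq_Max[OF finM(2) assms(20)] that finM(2) assms(29) \<theta>_def
    by (metis Max_ge finite_imageI imageI le_less_trans)
  have light1: "w {m t, t} < \<theta>" if "t \<in> B\<^sub>1 - {b\<^sub>1}" for t
    using M1_light[of "{m t, t}"] that assms(25-27) M1 disj(3) by (auto simp: doubleton_eq_iff)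
  have light2: "w {m t, t} < \<theta>" if "t \<in> B\<^sub>2" for t
    using M2_light that M2 by blast
  define r\<^sub>1 where "r\<^sub>1 = exchange w \<theta> (\<lambda>t. t) m B\<^sub>1"
  define r\<^sub>2 where "r\<^sub>2 = exchange w \<theta> (\<lambda>t. t) m B\<^sub>2"
  define r where "r = exchange w \<theta> (\<lambda>t. t) m (B\<^sub>1 \<union> B\<^sub>2)"
  have r_sub: "r\<^sub>1 \<subseteq> r" "r\<^sub>2 \<subseteq> r"
    unfolding r\<^sub>1_def r\<^sub>2_def r_def by (simp_all add: exchange_mono)
  \<comment> \<open>Taken at the threshold \<open>w e\<^sub>1\<close> itself, the criterion would
    turn a cycle into \<open>w e\<^sub>1 < w e\<^sub>1\<close>.\<close>
  have no_cycle: "(b\<^sub>1, b\<^sub>1) \<notin> r\<^sub>1\<^sup>+"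
    using bottleneck_less_iff[OF assms(17,19) fin(1,3) disj(3) cards(1) ne(3), of "w e\<^sub>1"]
      light_matching_iff_cycle[where w = w and \<theta> = \<theta>, OF bij1 fin(3) assms(26) light1]
    unfolding r\<^sub>1_def \<theta>_def by (metis less_irrefl)
  have cycle: "w e\<^sub>3 < \<theta> \<longleftrightarrow> (b\<^sub>1, b\<^sub>1) \<in> r\<^sup>+"
  proof -
    obtain M\<^sub>3 where M3: "bot_solution w (complete_bipartite (A\<^sub>1 \<union> A\<^sub>2) (B\<^sub>1 \<union> B\<^sub>2)) M\<^sub>3"
      "e\<^sub>3 \<in> argmax_edges w M\<^sub>3"
      using assms(31) unfolding bottleneck_edge_def by blast
    have "card (B\<^sub>1 \<union> B\<^sub>2) \<le> card (A\<^sub>1 \<union> A\<^sub>2)"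
      using bij_betw_same_card[OF bij3] by simp
    then have "w e\<^sub>3 < \<theta> \<longleftrightarrow> (\<exists>\<mu>. inj_on \<mu> (B\<^sub>1 \<union> B\<^sub>2) \<and> \<mu> ` (B\<^sub>1 \<union> B\<^sub>2) \<subseteq> A\<^sub>1 \<union> A\<^sub>2 \<and>
        (\<forall>t \<in> B\<^sub>1 \<union> B\<^sub>2. w {\<mu> t, t} < \<theta>))"
      using fin ne disj by (intro bottleneck_less_iff[OF M3]) auto
    also have "\<dots> \<longleftrightarrow> (b\<^sub>1, b\<^sub>1) \<in> r\<^sup>+"
      unfolding r_def using fin assms(26) light1 light2
      by (intro light_matching_iff_cycle[OF bij3]) auto
    finally show ?thesis .
  qed

  \<comment> \<open>The two trees in terms of reachability\<close>
  have V: "a\<^sub>1 \<in> V\<^sub>\<mu>" "b\<^sub>1 \<in> V\<^sub>\<nu>" "V\<^sub>\<mu> \<union> V\<^sub>\<nu> = A\<^sub>1 \<union> B\<^sub>1" "V\<^sub>\<mu> \<inter> V\<^sub>\<nu> = {}"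
    and E: "E\<^sub>\<mu> \<union> E\<^sub>\<nu> \<subseteq> pruned_edges w ?E1 M\<^sub>1"
    and trees: "alternating_tree M\<^sub>1 V\<^sub>\<mu> E\<^sub>\<mu> a\<^sub>1" "alternating_tree M\<^sub>1 V\<^sub>\<nu> E\<^sub>\<nu> b\<^sub>1"
    using assms(28) unfolding tree_decomposition_def by simp_all
  \<comment> \<open>The ends of this edge lie in different trees, whose vertex sets are disjoint. As
    it is the only pruned edge that is not light, all tree edges are light.\<close>
  have no_e1: "{a\<^sub>1, b\<^sub>1} \<notin> E\<^sub>\<mu>" "{a\<^sub>1, b\<^sub>1} \<notin> E\<^sub>\<nu>"
    using alternating_tree_edge_subset trees V(1,2,4) by fastforce+
  have tree_light: "w e < \<theta>" "e \<in> ?E1" if "e \<in> E\<^sub>\<mu> \<union> E\<^sub>\<nu>" for e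
  proof -
    have "e \<noteq> e\<^sub>1"
      using that no_e1 assms(27) by blast
    moreover have "e \<in> M\<^sub>1 \<or> e \<in> ?E1 \<and> w e < \<theta>"
      using that E Max1 unfolding pruned_edges_def by blast
    moreover have "M\<^sub>1 \<subseteq> ?E1"
      using M1 A(1) unfolding complete_bipartite_def by blast
    ultimately show "w e < \<theta>" "e \<in> ?E1"
      using M1_light by blast+
  qed
  \<comment> \<open>Walks from \<open>b\<^sub>1\<close> have tasks at even and agents at odd
    positions, so an agent is entered by an unmatched edge, that is, by a genuine step.\<close>
  have nu: "if v \<in> B\<^sub>1 then (b\<^sub>1, v) \<in> r\<^sub>1\<^sup>* else \<exists>t \<in> B\<^sub>1. v = m t \<and> (b\<^sub>1, t) \<in> r\<^sub>1\<^sup>+"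
    if "v \<in> V\<^sub>\<nu>" for v
  proof (cases "v = b\<^sub>1")
    case False
    obtain P where P: "P \<subseteq> E\<^sub>\<nu>" "path_between b\<^sub>1 v P" "alternating M\<^sub>1 P"
      using alternating_tree_path[OF trees(2) \<open>v \<in> V\<^sub>\<nu>\<close> False] .
    obtain vs where vs: "vs \<noteq> []" "distinct vs" "hd vs = b\<^sub>1" "last vs = v" "P = walk_edges vs"
      using P(2) unfolding path_between_def by blast
    have "{b\<^sub>1, m b\<^sub>1} \<notin> P"
      using P(1) no_e1 mb1 by (auto simp: insert_commute)
    then have "if even (length vs - 1) then \<exists>t \<in> B\<^sub>1. vs ! (length vs - 1) = t \<and> (b\<^sub>1, t) \<in> r\<^sub>1\<^sup>*
      else \<exists>t \<in> B\<^sub>1. vs ! (length vs - 1) = m t \<and> (b\<^sub>1, t) \<in> r\<^sub>1\<^sup>+"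
      unfolding r\<^sub>1_def using vs P(1,3) tree_light assms(26) M1 inj(1) A(1) disj(3)
      by (intro alternating_walk_exchange[where M = M\<^sub>1])
        (auto simp: hd_conv_nth insert_commute complete_bipartite_commute[of B\<^sub>1])
    moreover have "vs ! (length vs - 1) = v"
      using vs(1,4) by (simp add: last_conv_nth)
    ultimately show ?thesis
      using A(1) disj(3) by (auto split: if_splits)
  qed (use assms(26) in auto)
  \<comment> \<open>Walks from the agent \<open>a\<^sub>1\<close> use the reversed relation. Now the
    tasks sit at odd positions, which yields at least one step back to
    \<open>b\<^sub>1\<close>.\<close>
  have mu: "if v \<in> B\<^sub>1 then (v, b\<^sub>1) \<in> r\<^sub>1\<^sup>+ else \<exists>t \<in> B\<^sub>1. v = m t \<and> (t, b\<^sub>1) \<in> r\<^sub>1\<^sup>*"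
    if "v \<in> V\<^sub>\<mu>" for v
  proof (cases "v = a\<^sub>1")
    case True
    then show ?thesis
      using mb1 assms(25,26) disj(3) by auto
  next
    case False
    obtain P where P: "P \<subseteq> E\<^sub>\<mu>" "path_between a\<^sub>1 v P" "alternating M\<^sub>1 P"
      using alternating_tree_path[OF trees(1) \<open>v \<in> V\<^sub>\<mu>\<close> False] .
    obtain vs where vs: "vs \<noteq> []" "distinct vs" "hd vs = a\<^sub>1" "last vs = v" "P = walk_edges vs"
      using P(2) unfolding path_between_def by blast
    have "{m b\<^sub>1, b\<^sub>1} \<notin> P"
      using P(1) no_e1 mb1 by auto
    then have "if even (length vs - 1)
      then \<exists>t \<in> B\<^sub>1. vs ! (length vs - 1) = m t \<and> (b\<^sub>1, t) \<in> (exchange w \<theta> m (\<lambda>t. t) B\<^sub>1)\<^sup>*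
      else \<exists>t \<in> B\<^sub>1. vs ! (length vs - 1) = t \<and> (b\<^sub>1, t) \<in> (exchange w \<theta> m (\<lambda>t. t) B\<^sub>1)\<^sup>+"
      using vs P(1,3) tree_light assms(26) M1 inj(1) A(1) disj(3) mb1
      by (intro alternating_walk_exchange[where M = M\<^sub>1]) (auto simp: hd_conv_nth)
    moreover have "vs ! (length vs - 1) = v"
      using vs(1,4) by (simp add: last_conv_nth)
    moreover have "exchange w \<theta> m (\<lambda>t. t) B\<^sub>1 = r\<^sub>1\<inverse>"
      unfolding r\<^sub>1_def by (rule exchange_converse)
    ultimately show ?thesis
      using A(1) disj(3) by (auto simp: rtrancl_converse trancl_converse split: if_splits)
  qed
  have cover: "v \<in> V\<^sub>\<mu> \<or> v \<in> V\<^sub>\<nu>" if "v \<in> A\<^sub>1 \<union> B\<^sub>1" for v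
    using V(3) that by blast
  \<comment> \<open>If \<open>t\<close> were in \<open>V\<^sub>\<mu>\<close>, it would lead back to
    \<open>b\<^sub>1\<close> and close a cycle of \<open>r\<^sub>1\<close>.\<close>
  have task_nu: "t \<in> V\<^sub>\<nu>" if "t \<in> B\<^sub>1" "(b\<^sub>1, t) \<in> r\<^sub>1\<^sup>*" for t
    using mu[of t] cover[of t] that no_cycle by (auto dest: rtrancl_trancl_trancl)
  have task_nu_iff: "t \<in> V\<^sub>\<nu> \<longleftrightarrow> (b\<^sub>1, t) \<in> r\<^sub>1\<^sup>*" if "t \<in> B\<^sub>1" for t
    using task_nu nu[of t] that by auto
  have m_inj: "m s = m t \<longleftrightarrow> s = t" if "s \<in> B\<^sub>1" "t \<in> B\<^sub>1" for s t
    using inj(1) that by (simp add: inj_on_eq_iff)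
  have mtB: "m t \<in> A\<^sub>1" "m t \<notin> B\<^sub>1" if "t \<in> B\<^sub>1" for t
    using that A(1) disj(3) by auto
  have agent_mu: "(t, b\<^sub>1) \<in> r\<^sub>1\<^sup>*" if "t \<in> B\<^sub>1" "m t \<in> V\<^sub>\<mu>" for t
    using mu[OF that(2)] that(1) mtB m_inj by auto
  \<comment> \<open>Such an agent lies in the other tree, so its task is reached from
    \<open>b\<^sub>1\<close>.\<close>
  have agent_not_mu: "(b\<^sub>1, t) \<in> r\<^sub>1\<^sup>*" if "t \<in> B\<^sub>1" "m t \<notin> V\<^sub>\<mu>" for t
    using nu[of "m t"] cover[of "m t"] that mtB m_inj by (auto intro: trancl_into_rtrancl)

  \<comment> \<open>Cycles as detours through the second graph\<close>
  have "(b\<^sub>1, b\<^sub>1) \<in> r\<^sup>+ \<longleftrightarrow> (\<exists>s \<in> B\<^sub>2. \<exists>j \<in> B\<^sub>2. (s, j) \<in> r\<^sub>2\<^sup>* \<and>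
    (\<exists>t \<in> V\<^sub>\<nu> \<inter> B\<^sub>1. (t, s) \<in> r) \<and> (\<exists>t \<in> B\<^sub>1. m t \<in> V\<^sub>\<mu> \<and> (j, t) \<in> r))" (is "_ \<longleftrightarrow> ?detour")
  proof
    assume ?detour
    then obtain s j t t' where *: "(s, j) \<in> r\<^sub>2\<^sup>*" "(b\<^sub>1, t) \<in> r\<^sub>1\<^sup>*" "(t, s) \<in> r" "(j, t') \<in> r"
      "(t', b\<^sub>1) \<in> r\<^sub>1\<^sup>*"
      using task_nu_iff agent_mu by blast
    then have "(b\<^sub>1, t) \<in> r\<^sup>*" "(s, j) \<in> r\<^sup>*" "(t', b\<^sub>1) \<in> r\<^sup>*"
      using r_sub[THEN rtrancl_mono] by (blast dest: subsetD)+
    have "(b\<^sub>1, s) \<in> r\<^sup>+"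
      using \<open>(b\<^sub>1, t) \<in> r\<^sup>*\<close> *(3) by (rule rtrancl_into_trancl1)
    also have "(s, t') \<in> r\<^sup>+"
      using \<open>(s, j) \<in> r\<^sup>*\<close> *(4) by (rule rtrancl_into_trancl1)
    also note \<open>(t', b\<^sub>1) \<in> r\<^sup>*\<close>
    finally show "(b\<^sub>1, b\<^sub>1) \<in> r\<^sup>+" .
  next
    assume c: "(b\<^sub>1, b\<^sub>1) \<in> r\<^sup>+"
    show ?detour
    proof (rule ccontr)
      assume no_detour: "\<not> ?detour"
      \<comment> \<open>Without a detour, the tasks of \<open>V\<^sub>\<nu>\<close> and those of \<open>B\<^sub>2\<close> reached from them are closed
        under \<open>r\<close>, and no step from them leads back to \<open>b\<^sub>1\<close>.\<close>
      define X where "X = {s \<in> B\<^sub>2. \<exists>t \<in> V\<^sub>\<nu> \<inter> B\<^sub>1. (t, s) \<in> r}"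
      define Y where "Y = {t \<in> B\<^sub>1. (b\<^sub>1, t) \<in> r\<^sub>1\<^sup>*} \<union> {j \<in> B\<^sub>2. \<exists>s \<in> X. (s, j) \<in> r\<^sub>2\<^sup>*}"
      have closed: "u \<in> Y - {b\<^sub>1}" if tY: "t \<in> Y" and tu_r: "(t, u) \<in> r" for t u
      proof -
        have tu: "t \<in> B\<^sub>1 \<union> B\<^sub>2" "u \<in> B\<^sub>1 \<union> B\<^sub>2"
          using tu_r unfolding r_def exchange_def by auto
        have step1: "(t, u) \<in> r\<^sub>1" if "t \<in> B\<^sub>1" "u \<in> B\<^sub>1"
          using that tu_r unfolding r_def r\<^sub>1_def exchange_def by auto
        have step2: "(t, u) \<in> r\<^sub>2" if "t \<in> B\<^sub>2" "u \<in> B\<^sub>2"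
          using that tu_r unfolding r_def r\<^sub>2_def exchange_def by auto
        consider "t \<in> B\<^sub>1" "u \<in> B\<^sub>1" | "t \<in> B\<^sub>1" "u \<in> B\<^sub>2" | "t \<in> B\<^sub>2" "u \<in> B\<^sub>1" | "t \<in> B\<^sub>2" "u \<in> B\<^sub>2"
          using tu by blast
        then show ?thesis
        proof cases
          case 1
          then have "(b\<^sub>1, t) \<in> r\<^sub>1\<^sup>*"
            using tY disj(2) unfolding Y_def by blast
          then have "(b\<^sub>1, u) \<in> r\<^sub>1\<^sup>+"
            using step1[OF 1] by (rule rtrancl_into_trancl1)
          then show ?thesis
            using 1 no_cycle unfolding Y_def by (auto intro: trancl_into_rtrancl)
        next
          case 2
          then have "t \<in> V\<^sub>\<nu>"
            using tY disj(2) task_nu unfolding Y_def by blast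
          then have "u \<in> X"
            using 2 tu_r unfolding X_def by blast
          then show ?thesis
            using 2 assms(26) disj(2) unfolding Y_def by blast
        next
          case 3
          then obtain s where "s \<in> X" "(s, t) \<in> r\<^sub>2\<^sup>*"
            using tY disj(2) unfolding Y_def by blast
          \<comment> \<open>A return to \<open>u\<close> with \<open>m u\<close> in
            \<open>V\<^sub>\<mu>\<close> would complete a detour. Hence \<open>u\<close> is already
            reached inside \<open>B\<^sub>1\<close>, and it differs from \<open>b\<^sub>1\<close>,
            whose agent \<open>a\<^sub>1\<close> is in \<open>V\<^sub>\<mu>\<close>.\<close>
          then have "m u \<notin> V\<^sub>\<mu>"
            using 3 tu_r no_detour unfolding X_def by blast
          moreover have "m b\<^sub>1 \<in> V\<^sub>\<mu>"
            using V(1) mb1 by simp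
          ultimately show ?thesis
            using agent_not_mu 3 unfolding Y_def by auto
        next
          case 4
          then obtain s where s: "s \<in> X" "(s, t) \<in> r\<^sub>2\<^sup>*"
            using tY disj(2) unfolding Y_def by blast
          from s(2) step2[OF 4] have "(s, u) \<in> r\<^sub>2\<^sup>*"
            by (rule rtrancl_into_rtrancl)
          with s(1) show ?thesis
            using 4 assms(26) disj(2) unfolding Y_def by blast
        qed
      qed
      have "b\<^sub>1 \<in> Y"
        using assms(26) unfolding Y_def by simp
      have "u \<in> Y - {b\<^sub>1}" if "(b\<^sub>1, u) \<in> r\<^sup>+" for u
        using that closed[OF \<open>b\<^sub>1 \<in> Y\<close>]
      proof (induction rule: trancl_induct)
        case (step t u)
        then show ?case
          using closed[of t u] by simp
      qed
      from this[OF c] show False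
        by simp
    qed
  qed
  \<comment> \<open>The agent \<open>i\<close> is \<open>m s\<close>: entering \<open>s\<close> from
    \<open>b'\<close> uses the light edge \<open>{i, b'}\<close>, and leaving \<open>j\<close> uses
    the light edge \<open>{a', j}\<close>, where \<open>a'\<close> is the agent of the task
    entered.\<close>
  also have "\<dots> \<longleftrightarrow> (\<exists>i \<in> A\<^sub>2. \<exists>j \<in> B\<^sub>2.
       (\<exists>b' \<in> V\<^sub>\<nu> \<inter> B\<^sub>1. w {i, b'} < \<theta>) \<and>
       (\<exists>a' \<in> V\<^sub>\<mu> \<inter> A\<^sub>1. w {a', j} < \<theta>) \<and>
       (\<exists>P \<subseteq> complete_bipartite (A\<^sub>1 \<union> A\<^sub>2) (B\<^sub>1 \<union> B\<^sub>2).
          path_between i j P \<and> alternating M\<^sub>2 P \<and> (\<forall>e \<in> P. w e < \<theta>) \<and>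
          card (P \<inter> M\<^sub>2) > card (P - M\<^sub>2)))" (is "_ \<longleftrightarrow> ?paths")
  proof
    assume ?detour
    then obtain s j t u where *: "s \<in> B\<^sub>2" "j \<in> B\<^sub>2" "(s, j) \<in> r\<^sub>2\<^sup>*" "t \<in> V\<^sub>\<nu> \<inter> B\<^sub>1" "(t, s) \<in> r"
      "u \<in> B\<^sub>1" "m u \<in> V\<^sub>\<mu>" "(j, u) \<in> r"
      by blast
    obtain P where P: "P \<subseteq> complete_bipartite A\<^sub>2 B\<^sub>2" "path_between (m s) j P" "alternating M\<^sub>2 P"
      "\<forall>e \<in> P. w e < \<theta>" "card (P - M\<^sub>2) < card (P \<inter> M\<^sub>2)"
      using exchange_alternating_path[where w = w and \<theta> = \<theta>,
          OF bij2 disj(6) *(1) light2 M2 *(3)[unfolded r\<^sub>2_def]] by blast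
    have "P \<subseteq> complete_bipartite (A\<^sub>1 \<union> A\<^sub>2) (B\<^sub>1 \<union> B\<^sub>2)"
      using P(1) unfolding complete_bipartite_def by blast
    moreover have "w {m s, t} < \<theta>" "w {m u, j} < \<theta>"
      using *(5,8) unfolding r_def exchange_def by (simp_all add: insert_commute)
    moreover have "m s \<in> A\<^sub>2" "m u \<in> A\<^sub>1"
      using *(1,6) A by auto
    ultimately show ?paths
      using P(2-5) *(2,4,7)
      by (intro bexI[of _ "m s"] bexI[of _ j] conjI bexI[of _ t] bexI[of _ "m u"] exI[of _ P]) auto
  next
    assume ?paths
    then obtain i j b' a' P where *: "i \<in> A\<^sub>2" "j \<in> B\<^sub>2" "b' \<in> V\<^sub>\<nu> \<inter> B\<^sub>1" "w {i, b'} < \<theta>"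
      "a' \<in> V\<^sub>\<mu> \<inter> A\<^sub>1" "w {a', j} < \<theta>"
      and P: "P \<subseteq> complete_bipartite (A\<^sub>1 \<union> A\<^sub>2) (B\<^sub>1 \<union> B\<^sub>2)" "path_between i j P"
        "alternating M\<^sub>2 P" "\<forall>e \<in> P. w e < \<theta>" "card (P - M\<^sub>2) < card (P \<inter> M\<^sub>2)"
      by blast
    have "(A\<^sub>1 \<union> A\<^sub>2) \<inter> (B\<^sub>1 \<union> B\<^sub>2) = {}"
      using disj by blast
    \<comment> \<open>The path may run through the whole joined graph; alternation relative to
      \<open>M\<^sub>2\<close> and the surplus of matched edges bring it back to the second
      one.\<close>
    then obtain s where s: "s \<in> B\<^sub>2" "i = m s" "(s, j) \<in> r\<^sub>2\<^sup>*"
      using alternating_path_exchange[OF bij2 M2 _ _ _ *(1,2) P(1-3) _ P(5), of w \<theta>] P(4)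
      unfolding r\<^sub>2_def by blast
    obtain u where u: "u \<in> B\<^sub>1" "a' = m u"
      using *(5) A(1) by blast
    have "(b', s) \<in> r" "(j, u) \<in> r"
      using * s u unfolding r_def exchange_def by (auto simp: insert_commute)
    then show ?detour
      using s u * by blast
  qed
  finally show ?thesis
    using cycle unfolding \<theta>_def by simp
qed

end
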